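(* There exists an instance of the dynamic service recommendation problem with three services for which the optimal recommendation cannot be represented by service-specific local-state indices of the form $I_{j,t}(Q_j(t))$.
   Context: Problem. A platform operates $n$ parallel first-in-first-out services over periods $t\in[T]=\{1,\dots,T\}$; $Q_j(t)\in\mathbb Z_+$ is the queue length of service $j\in[n]$ at the beginning of period $t$, and all services are initially empty, $Q_j(1)=0$. An instance is given by arrival probabilities $\lambda_t\in(0,1]$, a constant $\gamma>1$, and for each service $j$ a revenue $r_j$, a parameter $p_j\in[0,1]$ and a service probability $\xi_j\in(0,1]$. In each period $t$ a customer arrives with probability $\lambda_t$, independently across periods and of the service opportunities. If a customer arrives, the platform may recommend one service or make no recommendation. A customer who is recommended service $j$ when its queue length is $q$ joins it with probability $a_j(q)=p_j\gamma^{-q/\xi_j}$, and otherwise leaves. Then services occur: $Q_j(t+1)=(Q_j(t)+A_{j,t}-B_{j,t})^+$, where $A_{j,t}\in\{0,1\}$ indicates whether a customer joins service $j$ in period $t$ and the $B_{j,t}\sim\mathrm{Bernoulli}(\xi_j)$ are mutually independent. The platform observes the queue lengths and all past arrival and joining outcomes, and maximizes the expected value of $\sum_{t=1}^T\sum_{j=1}^n r_jA_{j,t}-\sum_{j=1}^n r_jQ_j(T+1)$ over all (possibly randomized, history-dependent) policies. Optimal recommendation. Let $j=0$ denote making no recommendation, with $\boldsymbol e_0=\boldsymbol 0$, $a_0\equiv0$, $r_0=0$, and let $\boldsymbol e_j$ be the $j$-th unit vector for $j\in[n]$. The maximum expected net revenue $V(t,\boldsymbol q)$ from periods $t,\dots,T$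 given $\boldsymbol Q(t)=\boldsymbol q$ satisfies $V(T+1,\boldsymbol q)=-\sum_{j=1}^n r_jq_j$ and, for $t\in[T]$, $$V(t,\boldsymbol q)=\max_{j\in\{0,1,\dots,n\}}\Big\{\mathbb E[V(t+1,(\boldsymbol q-\boldsymbol B_t)^+)]+\lambda_ta_j(q_j)\Big(r_j+\mathbb E[V(t+1,(\boldsymbol q+\boldsymbol e_j-\boldsymbol B_t)^+)-V(t+1,(\boldsymbol q-\boldsymbol B_t)^+)]\Big)\Big\},$$ where $\boldsymbol B_t=(B_{1,t},\dots,B_{n,t})$ and $(\cdot)^+$ is componentwise. An optimal recommendation at $(t,\boldsymbol q)$ is an action attaining this maximum. Local-state index policies. At period $t$, such a policy assigns each service $j$ a score $I_{j,t}(Q_j(t))$, where $I_{j,t}(\cdot)$ may depend arbitrarily on time and on all primitive parameters of the problem instance, but its dependence on the current system state is restricted to the local queue length $Q_j(t)$. The recommendation is determined by comparing these local-state indices, with ties resolved according to a rule fixed independently of the realized joint queue state. *)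

theory Defs
  imports "HOL-Probability.Probability" "HOL-Library.Monad_Syntax"
begin

text \<open>
  Services are numbered from 1 to \<open>num_services\<close>; the action 0 makes no recommendation.
  Periods are numbered from 1 to \<open>horizon\<close>.
\<close>

record service_instance =
  num_services :: nat
  horizon :: nat
  arrival_prob :: "nat \<Rightarrow> real"
  gamma :: real
  revenue :: "nat \<Rightarrow> real"
  join_param :: "nat \<Rightarrow> real"
  service_prob :: "nat \<Rightarrow> real"

definition valid_instance :: "service_instance \<Rightarrow> bool" where
  "valid_instance I \<longleftrightarrow>
     1 \<le> num_services I \<and> 1 \<le> horizon I \<and> 1 < gamma I \<and>
     (\<forall>t\<in>{1..horizon I}. 0 < arrival_prob I t \<and> arrival_prob I t \<le> 1) \<and>
     (\<forall>j\<in>{1..num_services I}.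
        0 \<le> join_param I j \<and> join_param I j \<le> 1 \<and>
        0 < service_prob I j \<and> service_prob I j \<le> 1)"

type_synonym queues = "nat \<Rightarrow> nat"

text \<open>One past period: queue lengths, arrival, recommendation, joining outcome.\<close>
type_synonym observation = "queues \<times> bool \<times> nat \<times> bool"

text \<open>A policy maps the current period, the past observations (oldest first) and the current
  queue lengths to a distribution over actions, used if a customer arrives.\<close>
type_synonym policy = "nat \<Rightarrow> observation list \<Rightarrow> queues \<Rightarrow> nat pmf"

definition actions :: "service_instance \<Rightarrow> nat set" where
  "actions I = {0..num_services I}"

definition policies :: "service_instance \<Rightarrow> policy set" where
  "policies I = {\<pi>. \<forall>t h q. set_pmf (\<pi> t h q) \<subseteq> actions I}"

definition join_prob :: "service_instance \<Rightarrow> nat \<Rightarrow> nat \<Rightarrow> real" where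
  "join_prob I j x =
     (if j = 0 then 0 else join_param I j * gamma I powr (- real x / service_prob I j))"

definition action_revenue :: "service_instance \<Rightarrow> nat \<Rightarrow> real" where
  "action_revenue I j = (if j = 0 then 0 else revenue I j)"

text \<open>\<open>q + e\<^sub>j\<close>, where \<open>e\<^sub>0 = 0\<close>\<close>
definition enqueue :: "nat \<Rightarrow> queues \<Rightarrow> queues" where
  "enqueue j q = (if j = 0 then q else q(j := Suc (q j)))"

text \<open>Subtraction on \<^typ>\<open>nat\<close> truncates, so this is \<open>(q - B)\<^sup>+\<close>.\<close>
definition serve :: "(nat \<Rightarrow> bool) \<Rightarrow> queues \<Rightarrow> queues" where
  "serve B q = (\<lambda>i. q i - of_bool (B i))"

definition service_pmf :: "service_instance \<Rightarrow> (nat \<Rightarrow> bool) pmf" where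
  "service_pmf I =
     Pi_pmf {1..num_services I} False (\<lambda>j. bernoulli_pmf (service_prob I j))"

definition step ::
  "service_instance \<Rightarrow> policy \<Rightarrow> nat \<Rightarrow> observation list \<Rightarrow> queues \<Rightarrow> (observation list \<times> queues) pmf"
where
  "step I \<pi> t h q = do {
     arrives \<leftarrow> bernoulli_pmf (arrival_prob I t);
     j \<leftarrow> (if arrives then \<pi> t h q else return_pmf 0);
     joins \<leftarrow> bernoulli_pmf (join_prob I j (q j));
     B \<leftarrow> service_pmf I;
     return_pmf (h @ [(q, arrives, j, joins)], serve B (if joins then enqueue j q else q))
   }"

text \<open>\<open>run I \<pi> t m h q\<close>: the history and queue lengths after the \<open>m\<close> periods \<open>t, \<dots>, t + m - 1\<close>.\<close>
primrec run ::
  "service_instance \<Rightarrow> policy \<Rightarrow> nat \<Rightarrow> nat \<Rightarrow> observation list \<Rightarrow> queues \<Rightarrow> (observation list \<times> queues) pmf"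
where
  "run I \<pi> t 0 h q = return_pmf (h, q)"
| "run I \<pi> t (Suc m) h q = do {
     (h', q') \<leftarrow> step I \<pi> t h q;
     run I \<pi> (Suc t) m h' q'
   }"

definition terminal_value :: "service_instance \<Rightarrow> queues \<Rightarrow> real" where
  "terminal_value I q = - (\<Sum>j\<in>{1..num_services I}. revenue I j * real (q j))"

definition collected_revenue :: "service_instance \<Rightarrow> observation list \<Rightarrow> real" where
  "collected_revenue I h =
     (\<Sum>(q, arrives, j, joins)\<leftarrow>h. action_revenue I j * of_bool joins)"

definition net_revenue :: "service_instance \<Rightarrow> observation list \<times> queues \<Rightarrow> real" where
  "net_revenue I = (\<lambda>(h, q). collected_revenue I h + terminal_value I q)"

definition expected_net_revenue :: "service_instance \<Rightarrow> policy \<Rightarrow> nat \<Rightarrow> queues \<Rightarrow> real" where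
  "expected_net_revenue I \<pi> t q =
     measure_pmf.expectation (run I \<pi> t (Suc (horizon I) - t) [] q) (net_revenue I)"

text \<open>The supremum is attained, and it satisfies the Bellman equation: see
  \<open>V_attained\<close>, \<open>V_terminal\<close> and \<open>V_bellman\<close> below.\<close>
definition V :: "service_instance \<Rightarrow> nat \<Rightarrow> queues \<Rightarrow> real" where
  "V I t q = (SUP \<pi>\<in>policies I. expected_net_revenue I \<pi> t q)"

text \<open>The expression maximised in the Bellman equation, with \<open>F\<close> for \<open>V(t + 1, \<cdot>)\<close>\<close>
definition backup :: "service_instance \<Rightarrow> (queues \<Rightarrow> real) \<Rightarrow> nat \<Rightarrow> queues \<Rightarrow> nat \<Rightarrow> real" where
  "backup I F t q j =
     measure_pmf.expectation (service_pmf I) (\<lambda>B. F (serve B q)) +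
     arrival_prob I t * join_prob I j (q j) *
       (action_revenue I j +
        measure_pmf.expectation (service_pmf I) (\<lambda>B. F (serve B (enqueue j q)) - F (serve B q)))"

definition action_value :: "service_instance \<Rightarrow> nat \<Rightarrow> queues \<Rightarrow> nat \<Rightarrow> real" where
  "action_value I t q j = backup I (V I (Suc t)) t q j"

definition optimal_recommendation :: "service_instance \<Rightarrow> nat \<Rightarrow> queues \<Rightarrow> nat \<Rightarrow> bool" where
  "optimal_recommendation I t q j \<longleftrightarrow> is_arg_max (action_value I t q) (\<lambda>k. k \<in> actions I) j"

text \<open>Queue vectors that \<open>Q(t)\<close> takes with positive probability under some policy\<close>
definition reachable :: "service_instance \<Rightarrow> nat \<Rightarrow> queues \<Rightarrow> bool" where
  "reachable I t q \<longleftrightarrow>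
     (\<exists>\<pi>\<in>policies I. q \<in> snd ` set_pmf (run I \<pi> 1 (t - 1) [] (\<lambda>_. 0)))"

text \<open>Making no recommendation competes with a score of its own. It has no queue, so this score
  depends on the period only.\<close>
definition local_index ::
  "(nat \<Rightarrow> real) \<Rightarrow> (nat \<Rightarrow> nat \<Rightarrow> nat \<Rightarrow> real) \<Rightarrow> nat \<Rightarrow> queues \<Rightarrow> nat \<Rightarrow> real" where
  "local_index score0 score t q j = (if j = 0 then score0 t else score j t (q j))"

text \<open>A tie rule sees the period and the set of tied actions, and it may randomize.\<close>
definition tie_rule :: "service_instance \<Rightarrow> (nat \<Rightarrow> nat set \<Rightarrow> nat pmf) \<Rightarrow> bool" where
  "tie_rule I tie \<longleftrightarrow> (\<forall>t S. S \<noteq> {} \<longrightarrow> S \<subseteq> actions I \<longrightarrow> set_pmf (tie t S) \<subseteq> S)"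

definition index_recommendation ::
  "service_instance \<Rightarrow> (nat \<Rightarrow> real) \<Rightarrow> (nat \<Rightarrow> nat \<Rightarrow> nat \<Rightarrow> real) \<Rightarrow>
   (nat \<Rightarrow> nat set \<Rightarrow> nat pmf) \<Rightarrow> nat \<Rightarrow> queues \<Rightarrow> nat pmf" where
  "index_recommendation I score0 score tie t q =
     tie t {j. is_arg_max (local_index score0 score t q) (\<lambda>k. k \<in> actions I) j}"

definition local_index_representable :: "service_instance \<Rightarrow> bool" where
  "local_index_representable I \<longleftrightarrow>
     (\<exists>score0 score tie. tie_rule I tie \<and>
        (\<forall>t\<in>{1..horizon I}. \<forall>q. reachable I t q \<longrightarrow>
           (\<forall>j\<in>set_pmf (index_recommendation I score0 score tie t q).
              optimal_recommendation I t q j)))"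


subsection \<open>The value function satisfies the Bellman equation\<close>

lemma expectation_bind_finite:
  fixes g :: "'b \<Rightarrow> real"
  assumes "finite (set_pmf p)" "\<And>x. x \<in> set_pmf p \<Longrightarrow> finite (set_pmf (f x))"
  shows "measure_pmf.expectation (p \<bind> f) g =
         measure_pmf.expectation p (\<lambda>x. measure_pmf.expectation (f x) g)"
  using assms
  by (subst pmf_expectation_bind[of "set_pmf p"])
     (auto simp: integral_measure_pmf[of "set_pmf p"])

lemma expectation_mono_finite:
  fixes f g :: "'a \<Rightarrow> real"
  assumes "finite (set_pmf p)" "\<And>x. x \<in> set_pmf p \<Longrightarrow> f x \<le> g x"
  shows "measure_pmf.expectation p f \<le> measure_pmf.expectation p g"
  using assms
  by (intro integral_mono_AE integrable_measure_pmf_finite) (auto simp: AE_measure_pmf_iff)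

lemma finite_set_bernoulli [simp]: "finite (set_pmf (bernoulli_pmf x))"
  by (rule finite_subset[OF subset_UNIV]) simp

lemma finite_service_pmf [simp]: "finite (set_pmf (service_pmf I))"
  unfolding service_pmf_def
  by (rule finite_subset[OF set_Pi_pmf_subset']) (auto intro!: finite_PiE_dflt)

lemma integrable_service_pmf [simp]:
  "integrable (measure_pmf (service_pmf I)) (f :: _ \<Rightarrow> real)"
  by (rule integrable_measure_pmf_finite) simp

lemma finite_actions [simp]: "finite (actions I)"
  by (simp add: actions_def)

lemma zero_in_actions [simp]: "0 \<in> actions I"
  by (simp add: actions_def)

lemma finite_policy: "\<pi> \<in> policies I \<Longrightarrow> finite (set_pmf (\<pi> t h q))"
  unfolding policies_def by (blast intro: finite_subset[OF _ finite_actions])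

lemma finite_step:
  assumes "\<pi> \<in> policies I"
  shows "finite (set_pmf (step I \<pi> t h q))"
  using finite_policy[OF assms] by (auto simp: step_def)

lemma finite_run:
  assumes "\<pi> \<in> policies I"
  shows "finite (set_pmf (run I \<pi> t m h q))"
  by (induction m arbitrary: t h q) (auto simp: finite_step[OF assms])

lemma join_prob_bounds:
  assumes "valid_instance I" "j \<in> actions I"
  shows "0 \<le> join_prob I j x" "join_prob I j x \<le> 1"
proof -
  have "join_param I j * gamma I powr (- real x / service_prob I j) \<le> 1" if "j \<noteq> 0"
  proof -
    have "0 < service_prob I j" "0 \<le> join_param I j" "join_param I j \<le> 1" "1 < gamma I"
      using assms that by (auto simp: valid_instance_def actions_def)
    moreover from this have "gamma I powr (- real x / service_prob I j) \<le> gamma I powr 0"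
      by (intro powr_mono) (auto simp: divide_simps)
    ultimately show ?thesis
      using mult_mono[of "join_param I j" 1 "gamma I powr (- real x / service_prob I j)" 1] by simp
  qed
  then show "join_prob I j x \<le> 1" by (simp add: join_prob_def)
  show "0 \<le> join_prob I j x"
    using assms by (auto simp: join_prob_def valid_instance_def actions_def)
qed

lemma expectation_step:
  fixes G :: "observation list \<times> queues \<Rightarrow> real"
  assumes I: "valid_instance I" and t: "t \<in> {1..horizon I}" and \<pi>: "\<pi> \<in> policies I"
  assumes G: "\<And>a j x B q'. G (h @ [(q, a, j, x)], q') = c + action_revenue I j * of_bool x + F q'"
  shows "measure_pmf.expectation (step I \<pi> t h q) G =
         c + measure_pmf.expectation (\<pi> t h q) (backup I F t q)"
proof -
  let ?E = "measure_pmf.expectation (service_pmf I)"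
  define H where "H j = join_prob I j (q j) *
    (action_revenue I j + ?E (\<lambda>B. F (serve B (enqueue j q)) - F (serve B q)))" for j
  define K where "K a = (if a then \<pi> t h q else return_pmf 0)" for a
  have fK: "finite (set_pmf (K a))" for a by (simp add: K_def finite_policy[OF \<pi>])
  have sK: "set_pmf (K a) \<subseteq> actions I" for a using \<pi> by (auto simp: K_def policies_def)
  have int: "integrable (measure_pmf (\<pi> t h q)) (f :: _ \<Rightarrow> real)" for f
    by (rule integrable_measure_pmf_finite) (rule finite_policy[OF \<pi>])
  have lam: "0 \<le> arrival_prob I t" "arrival_prob I t \<le> 1"
    using I t by (auto simp: valid_instance_def intro: less_imp_le)
  have inner: "measure_pmf.expectation (bernoulli_pmf (join_prob I j (q j)) \<bind> (\<lambda>x.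
      service_pmf I \<bind> (\<lambda>B. return_pmf (h @ [(q, a, j, x)], serve B (if x then enqueue j q else q))))) G
      = c + ?E (\<lambda>B. F (serve B q)) + H j" if "j \<in> actions I" for a j
    using join_prob_bounds[OF I that, of "q j"]
    by (simp add: expectation_bind_finite G H_def algebra_simps)
  have "measure_pmf.expectation (step I \<pi> t h q) G =
    measure_pmf.expectation (bernoulli_pmf (arrival_prob I t)) (\<lambda>a.
      measure_pmf.expectation (K a) (\<lambda>j. c + ?E (\<lambda>B. F (serve B q)) + H j))"
    unfolding step_def K_def[symmetric]
    apply (subst expectation_bind_finite)
      apply (simp_all add: fK)
    apply (rule Bochner_Integration.integral_cong[OF refl])
    apply (subst expectation_bind_finite)
      apply (simp_all add: fK)
    apply (intro integral_cong_AE)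
      apply simp_all
    apply (simp add: AE_measure_pmf_iff)
    using sK inner by blast
  also have "\<dots> = c + ?E (\<lambda>B. F (serve B q)) +
      arrival_prob I t * measure_pmf.expectation (\<pi> t h q) H"
    using lam by (simp add: K_def int H_def[of 0] join_prob_def algebra_simps)
  also have "\<dots> = c + measure_pmf.expectation (\<pi> t h q) (backup I F t q)"
    unfolding backup_def[abs_def] by (simp add: int H_def[abs_def] mult.assoc)
  finally show ?thesis .
qed

text \<open>\<open>W I m q\<close> is the result of backward induction with \<open>m\<close> periods to go.\<close>
primrec W :: "service_instance \<Rightarrow> nat \<Rightarrow> queues \<Rightarrow> real" where
  "W I 0 q = terminal_value I q"
| "W I (Suc m) q = Max (backup I (W I m) (horizon I - m) q ` actions I)"

lemma collected_revenue_snoc: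
  "collected_revenue I (h @ [(q, a, j, x)]) = collected_revenue I h + action_revenue I j * of_bool x"
  by (simp add: collected_revenue_def)

lemma expectation_run_Suc:
  assumes "\<pi> \<in> policies I"
  shows "measure_pmf.expectation (run I \<pi> t (Suc m) h q) (net_revenue I) =
    measure_pmf.expectation (step I \<pi> t h q)
      (\<lambda>(h', q'). measure_pmf.expectation (run I \<pi> (Suc t) m h' q') (net_revenue I))"
  using assms
  by (simp add: expectation_bind_finite finite_step finite_run case_prod_beta' split_beta)

lemma expectation_run_le:
  assumes I: "valid_instance I" and \<pi>: "\<pi> \<in> policies I"
  shows "t + m = Suc (horizon I) \<Longrightarrow> 1 \<le> t \<Longrightarrow>
    measure_pmf.expectation (run I \<pi> t m h q) (net_revenue I) \<le> collected_revenue I h + W I m q"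
proof (induction m arbitrary: t h q)
  case 0
  then show ?case by (simp add: net_revenue_def)
next
  case (Suc m)
  then have t: "t \<in> {1..horizon I}" "horizon I - m = t" by auto
  have "measure_pmf.expectation (run I \<pi> t (Suc m) h q) (net_revenue I) \<le>
    measure_pmf.expectation (step I \<pi> t h q) (\<lambda>(h', q'). collected_revenue I h' + W I m q')"
    unfolding expectation_run_Suc[OF \<pi>]
    using Suc by (intro expectation_mono_finite finite_step[OF \<pi>]) auto
  also have "\<dots> = collected_revenue I h + measure_pmf.expectation (\<pi> t h q) (backup I (W I m) t q)"
    by (rule expectation_step[OF I t(1) \<pi>]) (simp add: collected_revenue_snoc)
  also have "measure_pmf.expectation (\<pi> t h q) (backup I (W I m) t q) \<le>
      measure_pmf.expectation (\<pi> t h q) (\<lambda>_. W I (Suc m) q)"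
    using \<pi> by (intro expectation_mono_finite finite_policy[OF \<pi>]) (fastforce simp: t policies_def intro!: Max_ge)
  finally show ?case by simp
qed

definition greedy_policy :: "service_instance \<Rightarrow> policy" where
  "greedy_policy I t h q =
     return_pmf (SOME j. j \<in> actions I \<and>
       backup I (W I (horizon I - t)) t q j = Max (backup I (W I (horizon I - t)) t q ` actions I))"

lemma greedy_policy:
  obtains j where "greedy_policy I t h q = return_pmf j" "j \<in> actions I"
    "backup I (W I (horizon I - t)) t q j = Max (backup I (W I (horizon I - t)) t q ` actions I)"
proof -
  let ?f = "backup I (W I (horizon I - t)) t q"
  have "Max (?f ` actions I) \<in> ?f ` actions I"
    by (intro Max_in) (auto intro: zero_in_actions)
  then have "\<exists>j. j \<in> actions I \<and> ?f j = Max (?f ` actions I)" by auto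
  from someI_ex[OF this] show ?thesis by (intro that) (auto simp: greedy_policy_def)
qed

lemma greedy_policy_in_policies: "greedy_policy I \<in> policies I"
proof -
  have "set_pmf (greedy_policy I t h q) \<subseteq> actions I" for t h q
    by (rule greedy_policy[of I t h q]) simp
  then show ?thesis by (simp add: policies_def)
qed

lemma expectation_run_greedy:
  assumes I: "valid_instance I"
  shows "t + m = Suc (horizon I) \<Longrightarrow> 1 \<le> t \<Longrightarrow>
    measure_pmf.expectation (run I (greedy_policy I) t m h q) (net_revenue I) =
    collected_revenue I h + W I m q"
proof (induction m arbitrary: t h q)
  case 0
  then show ?case by (simp add: net_revenue_def)
next
  case (Suc m)
  then have t: "t \<in> {1..horizon I}" "horizon I - m = t" "horizon I - t = m" by auto
  obtain j where j: "greedy_policy I t h q = return_pmf j"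
    "backup I (W I m) t q j = Max (backup I (W I m) t q ` actions I)"
    by (rule greedy_policy[of I t h q]) (auto simp: t)
  have "measure_pmf.expectation (run I (greedy_policy I) t (Suc m) h q) (net_revenue I) =
    measure_pmf.expectation (step I (greedy_policy I) t h q)
      (\<lambda>(h', q'). collected_revenue I h' + W I m q')"
    unfolding expectation_run_Suc[OF greedy_policy_in_policies]
    using Suc by simp
  also have "\<dots> = collected_revenue I h +
      measure_pmf.expectation (greedy_policy I t h q) (backup I (W I m) t q)"
    by (rule expectation_step[OF I t(1) greedy_policy_in_policies])
       (simp add: collected_revenue_snoc)
  also have "\<dots> = collected_revenue I h + W I (Suc m) q"
    by (simp add: j t)
  finally show ?case .
qed

lemma expected_net_revenue_bounds:
  assumes "valid_instance I" "1 \<le> t" "t \<le> Suc (horizon I)"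
  shows "\<pi> \<in> policies I \<Longrightarrow> expected_net_revenue I \<pi> t q \<le> W I (Suc (horizon I) - t) q"
    and "expected_net_revenue I (greedy_policy I) t q = W I (Suc (horizon I) - t) q"
  using assms
    expectation_run_le[of I \<pi> t "Suc (horizon I) - t" "[]" q]
    expectation_run_greedy[of I t "Suc (horizon I) - t" "[]" q]
  by (auto simp: expected_net_revenue_def collected_revenue_def)

lemma V_eq_W:
  assumes "valid_instance I" "1 \<le> t" "t \<le> Suc (horizon I)"
  shows "V I t q = W I (Suc (horizon I) - t) q"
  unfolding V_def
proof (rule cSup_eq_maximum)
  show "W I (Suc (horizon I) - t) q \<in> (\<lambda>\<pi>. expected_net_revenue I \<pi> t q) ` policies I"
    using expected_net_revenue_bounds(2)[OF assms, of q] greedy_policy_in_policies[of I]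
    by (metis image_eqI)
qed (auto intro: expected_net_revenue_bounds(1)[OF assms])

theorem V_attained:
  assumes "valid_instance I" "1 \<le> t" "t \<le> Suc (horizon I)"
  shows "\<exists>\<pi>\<in>policies I. expected_net_revenue I \<pi> t q = V I t q \<and>
           (\<forall>\<pi>'\<in>policies I. expected_net_revenue I \<pi>' t q \<le> V I t q)"
  using V_eq_W[OF assms] expected_net_revenue_bounds[OF assms] greedy_policy_in_policies by metis

theorem V_terminal:
  assumes "valid_instance I"
  shows "V I (Suc (horizon I)) q = - (\<Sum>j\<in>{1..num_services I}. revenue I j * real (q j))"
  using V_eq_W[OF assms, of "Suc (horizon I)"] by (simp add: terminal_value_def)

theorem V_bellman:
  assumes "valid_instance I" "t \<in> {1..horizon I}"
  shows "V I t q = Max (action_value I t q ` actions I)"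
proof -
  have "Suc (horizon I) - t = Suc (horizon I - t)" "horizon I - (horizon I - t) = t"
    using assms by auto
  moreover have "V I (Suc t) = W I (horizon I - t)"
    using assms V_eq_W[OF assms(1), of "Suc t"] by auto
  ultimately show ?thesis
    using V_eq_W[OF assms(1), of t q] assms by (simp add: action_value_def[abs_def])
qed

end

theory Submission
  imports Defs
begin

text \<open>
  In the last period but one, a recommendation of service 1 may leave its queue occupied and so
  unprofitable in the last period. How much that costs depends on the best service that is still
  empty then, hence on the queue of service 3. So the queue of service 3 can reverse the preference
  between services 1 and 2, which forces their scores to be equal. As the rule for breaking ties may
  depend on the set of tied actions, this is not yet a contradiction: service 3 could join the tie
  for one of its two queue lengths. Three further states rule this out.
\<close>

section \<open>Vectors over three services\<close>

text \<open>Polymorphic, to hold queue vectors as well as real parameters. With 0 elsewhere, the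
  empty system is \<open>triple 0 0 0\<close>.\<close>

definition triple :: "'a::zero \<Rightarrow> 'a \<Rightarrow> 'a \<Rightarrow> nat \<Rightarrow> 'a" where
  "triple a b c = (\<lambda>_. 0)(1 := a, 2 := b, 3 := c)"

lemma triple_simps [simp]:
  "triple a b c 1 = a" "triple a b c (Suc 0) = a" "triple a b c 2 = b" "triple a b c 3 = c"
  by (simp_all add: triple_def)

text \<open>The value \<open>False\<close> elsewhere agrees with the default of
  \<open>Pi_pmf\<close> in \<open>service_pmf\<close>.\<close>

definition services :: "bool \<Rightarrow> bool \<Rightarrow> bool \<Rightarrow> nat \<Rightarrow> bool" where
  "services a b c = (\<lambda>_. False)(1 := a, 2 := b, 3 := c)"

lemma serve_triple [simp]:
  "serve (services x y z) (triple a b c) = triple (a - of_bool x) (b - of_bool y) (c - of_bool z)"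
  by (auto simp: serve_def services_def triple_def fun_eq_iff)

lemma enqueue_triple [simp]:
  "enqueue 0 (triple a b c) = triple a b c"
  "enqueue (Suc 0) (triple a b c) = triple (Suc a) b c"
  "enqueue 2 (triple a b c) = triple a (Suc b) c"
  "enqueue 3 (triple a b c) = triple a b (Suc c)"
  by (auto simp: enqueue_def triple_def fun_eq_iff)

lemma actions_three: "num_services I = 3 \<Longrightarrow> actions I = {0, 1, 2, 3}"
  by (auto simp: actions_def)

section \<open>Index policies and ties\<close>

lemma is_arg_max_iff_eq:
  fixes f :: "'a \<Rightarrow> 'b::linorder"
  assumes "is_arg_max f P j"
  shows "is_arg_max f P k \<longleftrightarrow> P k \<and> f k = f j"
  using assms by (auto simp: is_arg_max_linorder intro: antisym)

text \<open>The support of the recommendation is nonempty and consists of optimal actions, so it is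
  the singleton of \<open>j\<close>; the tie rule takes it from the maximisers of the score.\<close>

lemma index_recommendation_unique:
  assumes "tie_rule I tie"
    and "\<And>j. j \<in> set_pmf (index_recommendation I score0 score tie t q) \<Longrightarrow> optimal_recommendation I t q j"
    and "\<And>k. optimal_recommendation I t q k \<Longrightarrow> k = j"
  shows "set_pmf (index_recommendation I score0 score tie t q) = {j}"
    and "is_arg_max (local_index score0 score t q) (\<lambda>k. k \<in> actions I) j"
proof -
  let ?S = "{j. is_arg_max (local_index score0 score t q) (\<lambda>k. k \<in> actions I) j}"
  show *: "set_pmf (index_recommendation I score0 score tie t q) = {j}"
    using assms(2,3) set_pmf_not_empty[of "index_recommendation I score0 score tie t q"] by blast
  let ?f = "local_index score0 score t q"
  \<comment> \<open>\<open>tie_rule\<close> constrains nonempty sets only, so a maximiser is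
    needed.\<close>
  have "Max (?f ` actions I) \<in> ?f ` actions I"
    by (intro Max_in) (auto intro: zero_in_actions)
  then obtain k where k: "k \<in> actions I" "?f k = Max (?f ` actions I)" by auto
  have "is_arg_max ?f (\<lambda>k. k \<in> actions I) k"
    unfolding is_arg_max_linorder k(2) using k(1) by simp
  then have "?S \<noteq> {}" by blast
  moreover have "?S \<subseteq> actions I" by (auto simp: is_arg_max_def)
  ultimately show "is_arg_max (local_index score0 score t q) (\<lambda>k. k \<in> actions I) j"
    using assms(1) * unfolding tie_rule_def index_recommendation_def by blast
qed

text \<open>
  The last three states put the score of service 1 at \<open>a'\<close> strictly below the tie of services 1
  and 2, but not below the score of service 3 at \<open>c\<close> or \<open>c'\<close>.
\<close>
lemma not_local_index_representable:
  assumes I: "num_services I = 3" and t: "t \<in> {1..horizon I}"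
    and reach: "\<And>q. q \<in> {triple a b c, triple a b c', triple a' b c, triple a' b' c, triple a' b' c'}
                  \<Longrightarrow> reachable I t q"
    and opt: "\<And>k. optimal_recommendation I t (triple a b c) k \<Longrightarrow> k = 1"
      "\<And>k. optimal_recommendation I t (triple a b c') k \<Longrightarrow> k = 2"
      "\<And>k. optimal_recommendation I t (triple a' b c) k \<Longrightarrow> k = 2"
      "\<And>k. optimal_recommendation I t (triple a' b' c) k \<Longrightarrow> k = 1"
      "\<And>k. optimal_recommendation I t (triple a' b' c') k \<Longrightarrow> k = 1"
  shows "\<not> local_index_representable I"
proof
  assume "local_index_representable I"
  then obtain score0 score tie where tie: "tie_rule I tie"
    and rep: "\<And>q j. reachable I t q \<Longrightarrow>
      j \<in> set_pmf (index_recommendation I score0 score tie t q) \<Longrightarrow> optimal_recommendation I t q j"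
    using t unfolding local_index_representable_def by blast
  let ?R = "index_recommendation I score0 score tie t"
  let ?s = "\<lambda>j x. score j t x"
  note uniq = index_recommendation_unique[OF tie rep]
  note arg_max = is_arg_max_linorder actions_three[OF I] local_index_def
  have rec: "set_pmf (?R (triple a b c)) = {1}" "set_pmf (?R (triple a b c')) = {2}"
    "set_pmf (?R (triple a' b c)) = {2}"
    by (rule uniq(1); use reach opt in blast)+
  have am: "is_arg_max (local_index score0 score t (triple a b c)) (\<lambda>k. k \<in> actions I) 1"
      "is_arg_max (local_index score0 score t (triple a b c')) (\<lambda>k. k \<in> actions I) 2"
      "is_arg_max (local_index score0 score t (triple a' b c)) (\<lambda>k. k \<in> actions I) 2"
      "is_arg_max (local_index score0 score t (triple a' b' c)) (\<lambda>k. k \<in> actions I) 1"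
      "is_arg_max (local_index score0 score t (triple a' b' c')) (\<lambda>k. k \<in> actions I) 1"
    by (rule uniq(2); use reach opt in blast)+
  \<comment> \<open>The first two states compare services 1 and 2 in opposite directions, which
    gives \<open>eq\<close>; the last two give \<open>ge\<close>.\<close>
  have eq: "?s 1 a = ?s 2 b" and le: "?s 3 c \<le> ?s 2 b" "?s 3 c' \<le> ?s 2 b" "?s 1 a' \<le> ?s 2 b"
    "score0 t \<le> ?s 2 b" and ge: "?s 3 c \<le> ?s 1 a'" "?s 3 c' \<le> ?s 1 a'"
    using am by (auto simp: arg_max)
  \<comment> \<open>Otherwise \<open>triple a b c\<close> and \<open>triple a' b c\<close> have
    equal scores, hence the same tied set, but different recommendations.\<close>
  have "?s 1 a' \<noteq> ?s 2 b"
  proof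
    assume "?s 1 a' = ?s 2 b"
    then have "local_index score0 score t (triple a b c) k = local_index score0 score t (triple a' b c) k"
      if "k \<in> actions I" for k
      using that eq by (auto simp: arg_max)
    then have "?R (triple a b c) = ?R (triple a' b c)"
      by (simp add: index_recommendation_def is_arg_max_linorder cong: conj_cong)
    then show False using rec by simp
  qed
  then have less: "?s 3 c < ?s 2 b" "?s 3 c' < ?s 2 b" using le ge by auto
  \<comment> \<open>Service 3 is now out of the tie for both queue lengths, and the score of action
    0 is the same in both states, so the tied sets agree.\<close>
  have "is_arg_max (local_index score0 score t (triple a b c)) (\<lambda>k. k \<in> actions I) k \<longleftrightarrow>
        is_arg_max (local_index score0 score t (triple a b c')) (\<lambda>k. k \<in> actions I) k" for k
    unfolding am[THEN is_arg_max_iff_eq] using eq less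
    by (auto simp: actions_three[OF I] local_index_def)
  then have "?R (triple a b c) = ?R (triple a b c')"
    by (simp add: index_recommendation_def)
  then show False using rec by simp
qed

section \<open>Reachable queue vectors\<close>

text \<open>Under the uniformly random policy it has positive probability that customers arrive, the
  recommendations follow \<open>js\<close>, all recommended customers join and no service
  occurs.\<close>

lemma reachable_fold_enqueue:
  assumes "valid_instance I" "Suc (length js) \<le> horizon I" "set js \<subseteq> actions I"
    and p: "\<And>j. j \<in> set js \<Longrightarrow> j \<noteq> 0 \<Longrightarrow> 0 < join_param I j"
    and \<xi>: "\<And>j. j \<in> {1..num_services I} \<Longrightarrow> service_prob I j < 1"
  shows "reachable I (Suc (length js)) (fold enqueue js (\<lambda>_. 0))"
proof -
  define \<pi> :: policy where "\<pi> = (\<lambda>_ _ _. pmf_of_set (actions I))"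
  have set_\<pi>: "set_pmf (\<pi> t h q) = actions I" for t h q
    unfolding \<pi>_def by (intro set_pmf_of_set) (auto intro: zero_in_actions)
  have idle: "(\<lambda>_. False) \<in> set_pmf (service_pmf I)"
  proof -
    have "pmf (service_pmf I) (\<lambda>_. False) = (\<Prod>j\<in>{1..num_services I}. 1 - service_prob I j)"
      unfolding service_pmf_def using assms(1)
      by (subst pmf_Pi) (auto intro!: prod.cong simp: valid_instance_def less_imp_le)
    also have "\<dots> > 0" using \<xi> by (intro prod_pos) simp
    finally show ?thesis by (simp add: set_pmf_iff)
  qed
  have step: "\<exists>h'. (h', enqueue j q) \<in> set_pmf (step I \<pi> t h q)"
    if "t \<in> {1..horizon I}" "j \<in> set js" for t h q j
  proof -
    have j: "j \<in> actions I" using assms(3) that by auto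
    have a: "True \<in> set_pmf (bernoulli_pmf (arrival_prob I t))"
    proof -
      have "0 < arrival_prob I t" "arrival_prob I t \<le> 1"
        using assms(1) that(1) by (auto simp: valid_instance_def)
      then show ?thesis by (simp add: set_pmf_iff pmf_bernoulli_True)
    qed
    \<comment> \<open>Action 0 has joining probability 0, so its only possible outcome is
      \<open>False\<close>.\<close>
    define x where "x = (j \<noteq> 0)"
    have x: "x \<in> set_pmf (bernoulli_pmf (join_prob I j (q j)))"
      using join_prob_bounds[OF assms(1) j, of "q j"] p[OF that(2)] assms(1)
      by (auto simp: x_def join_prob_def valid_instance_def set_pmf_iff pmf_bernoulli_True)
    have "(h @ [(q, True, j, x)], serve (\<lambda>_. False) (if x then enqueue j q else q))
        \<in> set_pmf (step I \<pi> t h q)"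
      unfolding step_def set_bind_pmf
      by (intro UN_I[OF a] UN_I[of j] UN_I[OF x] UN_I[OF idle]) (simp_all add: set_\<pi> j)
    moreover have "serve (\<lambda>_. False) (if x then enqueue j q else q) = enqueue j q"
      by (auto simp: serve_def x_def enqueue_def)
    ultimately show ?thesis by auto
  qed
  have "fold enqueue ks q \<in> snd ` set_pmf (run I \<pi> t (length ks) h q)"
    if "set ks \<subseteq> set js" "1 \<le> t" "t + length ks \<le> Suc (horizon I)" for ks t h q
    using that
  proof (induction ks arbitrary: t h q)
    case (Cons k ks)
    obtain h' where h': "(h', enqueue k q) \<in> set_pmf (step I \<pi> t h q)"
      using step[of t k q h] Cons.prems by auto
    have "fold enqueue ks (enqueue k q) \<in> snd ` set_pmf (run I \<pi> (Suc t) (length ks) h' (enqueue k q))"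
      using Cons.prems by (intro Cons.IH) auto
    then obtain h'' where
      "(h'', fold enqueue ks (enqueue k q)) \<in> set_pmf (run I \<pi> (Suc t) (length ks) h' (enqueue k q))"
      by auto
    then have "(h'', fold enqueue (k # ks) q) \<in> set_pmf (run I \<pi> t (length (k # ks)) h q)"
      unfolding list.size run.simps set_bind_pmf add_Suc_right add_0_right
      by (intro UN_I[OF h']) simp
    then show ?case by (rule image_eqI[rotated]) simp
  qed simp
  from this[of js 1] show ?thesis
    using assms(2) set_\<pi> unfolding reachable_def policies_def by (auto intro!: exI[of _ \<pi>])
qed

lemma expectation_service_three:
  fixes F :: "(nat \<Rightarrow> bool) \<Rightarrow> real"
  assumes "valid_instance I" "num_services I = 3"
  shows "measure_pmf.expectation (service_pmf I) F =
    (let E = \<lambda>j f. service_prob I j * f True + (1 - service_prob I j) * f False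
     in E 1 (\<lambda>x. E 2 (\<lambda>y. E 3 (\<lambda>z. F (services x y z)))))"
proof -
  have \<xi>: "0 \<le> service_prob I j" "service_prob I j \<le> 1" if "j \<in> {1,2,3}" for j
    using assms that by (auto simp: valid_instance_def less_imp_le)
  have "{1..num_services I} = {1, 2, 3}" using assms by auto
  then have "service_pmf I =
    do {x \<leftarrow> bernoulli_pmf (service_prob I 1); y \<leftarrow> bernoulli_pmf (service_prob I 2);
        z \<leftarrow> bernoulli_pmf (service_prob I 3); return_pmf (services x y z)}"
    by (simp add: service_pmf_def Pi_pmf_insert' bind_assoc_pmf bind_return_pmf services_def
        fun_upd_twist)
  then show ?thesis
    using \<xi> by (simp add: expectation_bind_finite Let_def mult.commute)
qed

section \<open>The counterexample\<close>

text \<open>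
  An empty service \<open>j\<close> is worth \<open>p\<^sub>j r\<^sub>j \<xi>\<^sub>j\<close> in the last period, that is 15/2, 6, 15/2. Periods 1 to 5 only
  serve to make all states with at most five customers reachable in period 6.
\<close>
definition counterexample :: service_instance where
  "counterexample = \<lparr>num_services = 3, horizon = 7, arrival_prob = (\<lambda>_. 1), gamma = 2,
     revenue = triple 20 30 15, join_param = triple (3/4) 1 1,
     service_prob = triple (1/2) (1/5) (1/2)\<rparr>"

lemma counterexample_simps [simp]:
  "num_services counterexample = 3" "horizon counterexample = 7"
  "arrival_prob counterexample t = 1" "gamma counterexample = 2"
  "revenue counterexample = triple 20 30 15" "join_param counterexample = triple (3/4) 1 1"
  "service_prob counterexample = triple (1/2) (1/5) (1/2)"
  by (simp_all add: counterexample_def)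

lemma valid_counterexample: "valid_instance counterexample"
proof -
  have "{1..3} = {1, 2, 3::nat}" by auto
  then show ?thesis by (simp add: valid_instance_def)
qed

lemma actions_counterexample: "actions counterexample = {0, 1, 2, 3}"
  by (rule actions_three) simp

lemma reachable_counterexample:
  assumes "a + b + c \<le> 5"
  shows "reachable counterexample 6 (triple a b c)"
proof -
  \<comment> \<open>The zeros pad the list to the five periods before period 6.\<close>
  define js where "js = replicate a (1::nat) @ replicate b 2 @ replicate c 3 @ replicate (5 - (a + b + c)) 0"
  have rep: "fold enqueue (replicate n 0) (triple x y z) = triple x y z"
    "fold enqueue (replicate n 1) (triple x y z) = triple (x + n) y z"
    "fold enqueue (replicate n 2) (triple x y z) = triple x (y + n) z"
    "fold enqueue (replicate n 3) (triple x y z) = triple x y (z + n)" for n x y z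
    by (induction n arbitrary: x y z) auto
  have "(\<lambda>_. 0) = triple 0 0 (0::nat)" by (auto simp: triple_def)
  then have "fold enqueue js (\<lambda>_. 0) = triple a b c"
    by (simp only: js_def fold_append o_apply rep) simp
  moreover have "length js = 5" using assms by (simp add: js_def)
  moreover have "reachable counterexample (Suc (length js)) (fold enqueue js (\<lambda>_. 0))"
  proof (rule reachable_fold_enqueue)
    show js: "set js \<subseteq> actions counterexample" by (auto simp: js_def actions_counterexample)
    show "0 < join_param counterexample j" if "j \<in> set js" "j \<noteq> 0" for j
      using js that by (auto simp: actions_counterexample)
    show "service_prob counterexample j < 1" if "j \<in> {1..num_services counterexample}" for j
    proof -
      have "j \<in> {1, 2, 3}" using that by auto
      then show ?thesis by auto
    qed
  qed (use \<open>length js = 5\<close> valid_counterexample in simp_all)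
  ultimately show ?thesis by simp
qed

lemma expectation_service_counterexample:
  fixes F :: "(nat \<Rightarrow> bool) \<Rightarrow> real"
  shows "measure_pmf.expectation (service_pmf counterexample) F =
    (F (services True True True) + F (services True True False) +
     4 * F (services True False True) + 4 * F (services True False False) +
     F (services False True True) + F (services False True False) +
     4 * F (services False False True) + 4 * F (services False False False)) / 20"
  by (simp add: expectation_service_three[OF valid_counterexample] field_simps)

lemma backup_counterexample:
  "backup counterexample F t q j =
    (let E = \<lambda>q. measure_pmf.expectation (service_pmf counterexample) (\<lambda>B. F (serve B q))
     in E q + join_prob counterexample j (q j) * (action_revenue counterexample j + E (enqueue j q) - E q))"
  by (simp add: backup_def Let_def)

lemma join_prob_counterexample [simp]:
  "join_prob counterexample 0 x = 0"
  "join_prob counterexample (Suc 0) 0 = 3/4" "join_prob counterexample (Suc 0) (Suc 0) = 3/16"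
  "join_prob counterexample 2 0 = 1"
  "join_prob counterexample 3 0 = 1" "join_prob counterexample 3 (Suc 0) = 1/4"
  by (simp_all add: join_prob_def powr_minus)

lemma action_revenue_counterexample [simp]:
  "action_revenue counterexample 0 = 0" "action_revenue counterexample (Suc 0) = 20"
  "action_revenue counterexample 2 = 30" "action_revenue counterexample 3 = 15"
  by (simp_all add: action_revenue_def)

text \<open>An occupied service recovers \<open>r\<^sub>j \<xi>\<^sub>j\<close> in expectation, and
  recommending it gains nothing, as the revenue is charged back at the end. The first summand is the
  best gain from an empty service.\<close>

lemma V_last:
  "V counterexample 7 (triple a b c) =
    (if a = 0 \<or> c = 0 then 15/2 else if b = 0 then 6 else 0)
     - (20 * a + 30 * b + 15 * c)
     + (if a = 0 then 0 else 10) + (if b = 0 then 0 else 6) + (if c = 0 then 0 else 15/2)"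
proof -
  have terminal: "W counterexample 0 (triple a b c) = - (20 * a + 30 * b + 15 * c)" for a b c
  proof -
    have "{1..3} = {1, 2, 3::nat}" by auto
    then show ?thesis by (simp add: terminal_value_def)
  qed
  define E where "E a b c = - (20 * a + 30 * b + 15 * c)
     + (if a = 0 then 0 else 10) + (if b = 0 then 0 else 6) + (if c = 0 then 0 else 15/2 :: real)"
    for a b c :: nat
  have E: "measure_pmf.expectation (service_pmf counterexample)
      (\<lambda>B. W counterexample 0 (serve B (triple a b c))) = E a b c" for a b c
    unfolding expectation_service_counterexample serve_triple terminal E_def
    by (cases a; cases b; cases c) simp_all
  let ?U = "backup counterexample (W counterexample 0) 7 (triple a b c)"
  have U: "?U 0 = E a b c" "?U (Suc 0) = E a b c + (if a = 0 then 15/2 else 0)"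
    "?U 2 = E a b c + (if b = 0 then 6 else 0)" "?U 3 = E a b c + (if c = 0 then 15/2 else 0)"
    unfolding backup_counterexample Let_def enqueue_triple E by (simp_all add: E_def)
  have "V counterexample 7 (triple a b c) = Max (?U ` {0, Suc 0, 2, 3})"
    using V_eq_W[OF valid_counterexample, of 7 "triple a b c"]
    by (simp add: actions_counterexample del: W.simps(1))
  also have "\<dots> = E a b c + (if a = 0 \<or> c = 0 then 15/2 else if b = 0 then 6 else 0)"
    by (simp add: U)
  finally show ?thesis by (simp add: E_def)
qed

lemma unique_optimal_recommendation:
  assumes "j \<in> actions I"
    and "\<And>k. k \<in> actions I \<Longrightarrow> k \<noteq> j \<Longrightarrow> action_value I t q k < action_value I t q j"
    and "optimal_recommendation I t q k"
  shows "k = j"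
  using assms unfolding optimal_recommendation_def is_arg_max_def by blast

text \<open>Gains are relative to action 0. With services 1 and 2 empty, service 2 gains 10.8, and
  service 1 gains 3/4 * (15 - 3/2 * P), where P is the probability that, after a join, services 1
  and 3 are both occupied in period 7. P is 1/4 or 1/2 for queue 1 or 2 of service 3, giving about
  10.97 or 10.69. At \<open>triple 1 0 1\<close>, service 2 gains 9.6 and the others less than 1. In
  the last two states service 1 gains about 0.59 and 0.23, service 3 about 0.47 and 0, service 2
  nothing.\<close>

lemma optimal_recommendation_counterexample:
  "optimal_recommendation counterexample 6 (triple 0 0 1) k \<Longrightarrow> k = 1"
  "optimal_recommendation counterexample 6 (triple 0 0 2) k \<Longrightarrow> k = 2"
  "optimal_recommendation counterexample 6 (triple 1 0 1) k \<Longrightarrow> k = 2"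
  "optimal_recommendation counterexample 6 (triple 1 2 1) k \<Longrightarrow> k = 1"
  "optimal_recommendation counterexample 6 (triple 1 2 2) k \<Longrightarrow> k = 1"
  by (erule unique_optimal_recommendation[rotated 2];
    auto simp: actions_counterexample action_value_def backup_counterexample
      expectation_service_counterexample V_last)+

theorem proposition1:
  shows "\<exists>I :: service_instance.
           valid_instance I \<and> num_services I = 3 \<and> \<not> local_index_representable I"
proof -
  have "\<not> local_index_representable counterexample"
    \<comment> \<open>Here \<open>a = b = 0\<close>, \<open>c = a' = 1\<close> and
      \<open>c' = b' = 2\<close>; the fullest state holds five customers.\<close>
    by (rule not_local_index_representable[of _ 6 0 0 1 2 1 2])
      (use optimal_recommendation_counterexample in
        \<open>auto intro: reachable_counterexample simp del: One_nat_def\<close>)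
  then show ?thesis
    using valid_counterexample by (intro exI[of _ counterexample]) simp
qed

end
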